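(* Let $\Theta_\approx$ be a first-order signature with equality. For every set $\Gamma\cup\{\varphi\}\subseteq For(\Theta_\approx)$: if $\Gamma\vdash_{\mathbf{QmbC}^\approx}\varphi$, then $\Gamma\models_{\mathbf{QmbC}^\approx}\varphi$ (semantical consequence with respect to first-order swap structures with standard equality).
   Context: **Language.** $Var$ is a denumerable set of individual variables. A first-order signature $\Theta$ consists of a set of individual constants and, for each $n\ge 1$, sets of function and predicate symbols of arity $n$. The signature with equality $\Theta_\approx$ is $\Theta$ plus a new binary predicate symbol $\approx$ (written infix). Formulas are built with binary connectives $\wedge,\vee,\to$, unary connectives $\neg,\circ$, and quantifiers $\forall,\exists$. For a signature $\Xi$, $For(\Xi)$ and $Sen(\Xi)$ are the sets of formulas and sentences. $\varphi[x/t]$ is the result of replacing every free occurrence of $x$ in $\varphi$ by $t$. If $y$ is a variable free for $x$ in $\varphi$, $\varphi[x\wr y]$ denotes any formula obtained from $\varphi$ by replacing some, not necessarily all (maybe none), free occurrences of $x$ by $y$. Two formulas are *variants* if one is obtained from the other by addition or deletion of void quantifiers, or by renaming bound variables (keeping the same free variables in the same places). **Calculus $\mathbf{QmbC}^\approx$** (Hilbert calculus over $For(\Theta_\approx)$). Axiom schemas: (A1) $\alpha\to(\beta\to\alpha)$; (A2) $(\alpha\to(\beta\to\gamma))\to((\alpha\to\beta)\to(\alpha\to\gamma))$; (A3) $\alpha\to(\beta\to(\alpha\wedge\beta))$; (A4) $(\alpha\wedge\beta)\to\alpha$; (A5) $(\alpha\wedge\beta)\to\beta$; (A6) $\alpha\to(\alpha\vee\beta)$;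 (A7) $\beta\to(\alpha\vee\beta)$; (A8) $(\alpha\to\gamma)\to((\beta\to\gamma)\to((\alpha\vee\beta)\to\gamma))$; (A9) $\alpha\vee(\alpha\to\beta)$; (A10) $\alpha\vee\neg\alpha$; (A11) $\circ\alpha\to(\alpha\to(\neg\alpha\to\beta))$; (Ax12) $\varphi[x/t]\to\exists x\varphi$ if $t$ is free for $x$ in $\varphi$; (Ax13) $\forall x\varphi\to\varphi[x/t]$ if $t$ is free for $x$ in $\varphi$; (Ax14) $\alpha\to\beta$ whenever $\alpha$ is a variant of $\beta$; (AxEq1) $\forall x(x\approx x)$; (AxEq2) $(x\approx y)\to(\varphi\to\varphi[x\wr y])$ if $y$ is a variable free for $x$ in $\varphi$. Rules: (MP) from $\alpha$, $\alpha\to\beta$ infer $\beta$; ($\exists$-In) from $\varphi\to\psi$ infer $\exists x\varphi\to\psi$ if $x$ is not free in $\psi$; ($\forall$-In) from $\varphi\to\psi$ infer $\varphi\to\forall x\psi$ if $x$ is not free in $\varphi$. $\Gamma\vdash_{\mathbf{QmbC}^\approx}\varphi$ means there is a finite derivation of $\varphi$ whose steps are axiom instances, members of $\Gamma$, or follow from earlier steps by a rule. **Swap structures.** For a Boolean algebra $\mathcal A$ with domain $A$, let $B_{\mathcal A}=\{x\in A^3: x_1\vee x_2=1,\ x_1\wedge x_2\wedge x_3=0\}$, where $x_i$ is the $i$-th coordinate. A *swap structure for mbC over $\mathcal A$* is a multialgebra $\mathcal B=(B,\tilde\wedge,\tilde\vee,\tilde\to,\tilde\neg,\tilde\circ)$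 with $\emptyset\neq B\subseteq B_{\mathcal A}$ (write $|\mathcal B|=B$) such that for all $x,y\in B$: $\emptyset\ne x\tilde\# y\subseteq\{z\in B: z_1=x_1\# y_1\}$ for $\#\in\{\wedge,\vee,\to\}$; $\emptyset\neq\tilde\neg x\subseteq\{z\in B: z_1=x_2\}$; $\emptyset\ne\tilde\circ x\subseteq\{z\in B: z_1=x_3\}$. Its Nmatrix is $\mathcal M(\mathcal B)=(\mathcal B,D)$ with $D=\{x\in B: x_1=1\}$. **Structures and valuations.** Let $\mathcal B$ be a swap structure for mbC over a *complete* Boolean algebra. A structure $\mathfrak A=\langle U,I_{\mathfrak A}\rangle$ over $\mathcal M(\mathcal B)$ and $\Theta_\approx$ has a nonempty domain $U$ and assigns $c^{\mathfrak A}\in U$ to constants, $f^{\mathfrak A}:U^n\to U$ to $n$-ary function symbols, and $P^{\mathfrak A}:U^n\to|\mathcal B|$ to $n$-ary predicate symbols (including $\approx$). It is a structure *with standard equality* if $I_{\mathfrak A}(\approx)(a,b)\in D$ iff $a=b$, for all $a,b\in U$. $\Theta_U^\approx$ is $\Theta_\approx$ plus a new constant $\bar a$ for each $a\in U$; $\widehat{\mathfrak A}$ extends $\mathfrak A$ by interpreting $\bar a$ as $a$. An assignment is a map $\mu:Var\to U$; $[\![t]\!]^{\widehat{\mathfrak A}}_\mu\in U$ is the usual value of a term $t$ (the subscript is omitted for closed terms); $\widehat\mu(s)$ is obtained from a term or formula $s$ over $\Theta_U^\approx$ by replacing each free variable $x$ by $\overline{\mu(x)}$; $\mu^x_a$ is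 $\mu$ changed to take value $a$ at $x$; $v_\mu(\varphi)=v(\widehat\mu(\varphi))$. A *QmbC-valuation* over $\mathfrak A$ and $\mathcal M(\mathcal B)$ is a map $v:Sen(\Theta_U^\approx)\to|\mathcal B|$ such that: (i) $v(P(t_1,\dots,t_n))=P^{\mathfrak A}([\![t_1]\!]^{\widehat{\mathfrak A}},\dots,[\![t_n]\!]^{\widehat{\mathfrak A}})$; (ii) $v(\#\varphi)\in\tilde\# v(\varphi)$ for $\#\in\{\neg,\circ\}$; (iii) $v(\varphi\#\psi)\in v(\varphi)\tilde\# v(\psi)$ for $\#\in\{\wedge,\vee,\to\}$; (iv) $(v(\forall x\varphi))_1=\bigwedge_{a\in U}(v(\varphi[x/\bar a]))_1$; (v) $(v(\exists x\varphi))_1=\bigvee_{a\in U}(v(\varphi[x/\bar a]))_1$; (vi) whenever $t$ is free for $z$ in $\varphi$ and $\psi$, $\mu$ is an assignment and $b=[\![t]\!]^{\widehat{\mathfrak A}}_\mu$: (vi.1) if $v(\widehat\mu(\varphi[z/t]))=v(\widehat\mu(\varphi[z/\bar b]))$ then $v(\widehat\mu((\#\varphi)[z/t]))=v(\widehat\mu((\#\varphi)[z/\bar b]))$ for $\#\in\{\neg,\circ\}$; (vi.2) if $v(\widehat\mu(\varphi[z/t]))=v(\widehat\mu(\varphi[z/\bar b]))$ and $v(\widehat\mu(\psi[z/t]))=v(\widehat\mu(\psi[z/\bar b]))$ then $v(\widehat\mu((\varphi\#\psi)[z/t]))=v(\widehat\mu((\varphi\#\psi)[z/\bar b]))$ for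 $\#\in\{\wedge,\vee,\to\}$; (vi.3) if $x\ne z$, $x$ does not occur in $t$, and $v(\widehat{\mu^x_a}(\varphi[z/t]))=v(\widehat{\mu^x_a}(\varphi[z/\bar b]))$ for every $a\in U$, then $v(\widehat\mu((Qx\varphi)[z/t]))=v(\widehat\mu((Qx\varphi)[z/\bar b]))$ for $Q\in\{\forall,\exists\}$; (vii) $v(\varphi)=v(\varphi')$ if $\varphi,\varphi'$ are variants. If $\mathfrak A$ has standard equality, a *$\mathbf{QmbC}^\approx$-valuation* over $\mathfrak A$ and $\mathcal M(\mathcal B)$ is a QmbC-valuation that also satisfies (viii) $v_\mu((x\approx y)\to(\varphi\to\varphi[x\wr y]))\in D$ for every $\mu$, if $y$ is a variable free for $x$ in $\varphi$. **Consequence.** $\Gamma\models^\approx_{(\mathfrak A,\mathcal M(\mathcal B))}\varphi$ iff for every $\mathbf{QmbC}^\approx$-valuation $v$ over $\mathfrak A$ and $\mathcal M(\mathcal B)$: if $v_\mu(\gamma)\in D$ for all $\gamma\in\Gamma$ and all $\mu$, then $v_\mu(\varphi)\in D$ for all $\mu$. $\Gamma\models_{\mathbf{QmbC}^\approx}\varphi$ iff $\Gamma\models^\approx_{(\mathfrak A,\mathcal M(\mathcal B))}\varphi$ for every swap structure $\mathcal B$ for mbC over a complete Boolean algebra and every structure $\mathfrak A$ with standard equality over $\mathcal M(\mathcal B)$ and $\Theta_\approx$. *)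

theory Defs
  imports Main
begin

section \<open>First-order syntax\<close>

text \<open>Individual variables are natural numbers. Terms and formulas are raw syntax; membership in
  the language of a signature is expressed by \<open>Ter\<close> and \<open>For\<close> below.\<close>

datatype ('c, 'f) tm =
    Var nat
  | Cnst 'c
  | Fun 'f "('c, 'f) tm list"

datatype unop = Neg | Circ
datatype binop = And | Or | Imp
datatype quantifier = Forall | Exists

datatype ('c, 'f, 'p) fm =
    Pred 'p "('c, 'f) tm list"
  | UnOp unop "('c, 'f, 'p) fm"
  | BinOp binop "('c, 'f, 'p) fm" "('c, 'f, 'p) fm"
  | Quant quantifier nat "('c, 'f, 'p) fm"

abbreviation neg_fm (\<open>\<^bold>\<not> _\<close> [70] 70) where "\<^bold>\<not> \<alpha> \<equiv> UnOp Neg \<alpha>"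
abbreviation circ_fm (\<open>\<^bold>\<circ> _\<close> [70] 70) where "\<^bold>\<circ> \<alpha> \<equiv> UnOp Circ \<alpha>"
abbreviation and_fm (infixr \<open>\<^bold>\<and>\<close> 65) where "\<alpha> \<^bold>\<and> \<beta> \<equiv> BinOp And \<alpha> \<beta>"
abbreviation or_fm (infixr \<open>\<^bold>\<or>\<close> 64) where "\<alpha> \<^bold>\<or> \<beta> \<equiv> BinOp Or \<alpha> \<beta>"
abbreviation imp_fm (infixr \<open>\<^bold>\<rightarrow>\<close> 63) where "\<alpha> \<^bold>\<rightarrow> \<beta> \<equiv> BinOp Imp \<alpha> \<beta>"

fun tm_vars :: "('c, 'f) tm \<Rightarrow> nat set" where
  "tm_vars (Var x) = {x}"
| "tm_vars (Cnst c) = {}"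
| "tm_vars (Fun f ts) = (\<Union>t\<in>set ts. tm_vars t)"

fun free_vars :: "('c, 'f, 'p) fm \<Rightarrow> nat set" where
  "free_vars (Pred P ts) = (\<Union>t\<in>set ts. tm_vars t)"
| "free_vars (UnOp k \<phi>) = free_vars \<phi>"
| "free_vars (BinOp k \<phi> \<psi>) = free_vars \<phi> \<union> free_vars \<psi>"
| "free_vars (Quant q x \<phi>) = free_vars \<phi> - {x}"

text \<open>Symbols of different arities live in different sets; the same name occurring with two
  arities counts as two symbols. The sets at arity 0 play no role.\<close>

record ('c, 'f, 'p) signature =
  csyms :: "'c set"
  fsyms :: "nat \<Rightarrow> 'f set"
  psyms :: "nat \<Rightarrow> 'p set"

inductive_set Ter :: "('c, 'f, 'p) signature \<Rightarrow> ('c, 'f) tm set" for \<Xi> where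
  "Var x \<in> Ter \<Xi>"
| "c \<in> csyms \<Xi> \<Longrightarrow> Cnst c \<in> Ter \<Xi>"
| "length ts \<ge> 1 \<Longrightarrow> f \<in> fsyms \<Xi> (length ts) \<Longrightarrow> \<forall>t\<in>set ts. t \<in> Ter \<Xi> \<Longrightarrow> Fun f ts \<in> Ter \<Xi>"

inductive_set For :: "('c, 'f, 'p) signature \<Rightarrow> ('c, 'f, 'p) fm set" for \<Xi> where
  "length ts \<ge> 1 \<Longrightarrow> P \<in> psyms \<Xi> (length ts) \<Longrightarrow> set ts \<subseteq> Ter \<Xi> \<Longrightarrow> Pred P ts \<in> For \<Xi>"
| "\<phi> \<in> For \<Xi> \<Longrightarrow> UnOp k \<phi> \<in> For \<Xi>"
| "\<phi> \<in> For \<Xi> \<Longrightarrow> \<psi> \<in> For \<Xi> \<Longrightarrow> BinOp k \<phi> \<psi> \<in> For \<Xi>"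
| "\<phi> \<in> For \<Xi> \<Longrightarrow> Quant q x \<phi> \<in> For \<Xi>"

definition Sen :: "('c, 'f, 'p) signature \<Rightarrow> ('c, 'f, 'p) fm set" where
  "Sen \<Xi> = {\<phi> \<in> For \<Xi>. free_vars \<phi> = {}}"

text \<open>The signature with equality adds a new binary predicate symbol \<open>Eq\<close>.\<close>

datatype 'p eq_pred = Eq | Base 'p

definition eq_sig :: "('c, 'f, 'p) signature \<Rightarrow> ('c, 'f, 'p eq_pred) signature" where
  "eq_sig \<Theta> = \<lparr>csyms = csyms \<Theta>, fsyms = fsyms \<Theta>,
     psyms = (\<lambda>n. Base ` psyms \<Theta> n \<union> (if n = 2 then {Eq} else {}))\<rparr>"

abbreviation eq_fm (infix \<open>\<^bold>\<approx>\<close> 75) where "s \<^bold>\<approx> t \<equiv> Pred Eq [s, t]"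


section \<open>Substitution and variants\<close>

text \<open>\<open>subst \<sigma> \<phi>\<close> replaces all free occurrences of variables simultaneously, without renaming bound
  variables (so capture is possible). Both \<open>\<phi>[x/t]\<close> and the map written \<open>\<mu>\<close>-hat are
  instances of it.\<close>

fun tm_subst :: "(nat \<Rightarrow> ('c, 'f) tm) \<Rightarrow> ('c, 'f) tm \<Rightarrow> ('c, 'f) tm" where
  "tm_subst \<sigma> (Var x) = \<sigma> x"
| "tm_subst \<sigma> (Cnst c) = Cnst c"
| "tm_subst \<sigma> (Fun f ts) = Fun f (map (tm_subst \<sigma>) ts)"

fun subst :: "(nat \<Rightarrow> ('c, 'f) tm) \<Rightarrow> ('c, 'f, 'p) fm \<Rightarrow> ('c, 'f, 'p) fm" where
  "subst \<sigma> (Pred P ts) = Pred P (map (tm_subst \<sigma>) ts)"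
| "subst \<sigma> (UnOp k \<phi>) = UnOp k (subst \<sigma> \<phi>)"
| "subst \<sigma> (BinOp k \<phi> \<psi>) = BinOp k (subst \<sigma> \<phi>) (subst \<sigma> \<psi>)"
| "subst \<sigma> (Quant q x \<phi>) = Quant q x (subst (\<sigma>(x := Var x)) \<phi>)"

definition subst1 :: "('c, 'f, 'p) fm \<Rightarrow> nat \<Rightarrow> ('c, 'f) tm \<Rightarrow> ('c, 'f, 'p) fm"
    (\<open>_[_ \<^bold>'/ _]\<close> [1000, 0, 0] 1000) where
  "\<phi>[x \<^bold>/ t] = subst (Var(x := t)) \<phi>"

fun free_for :: "('c, 'f) tm \<Rightarrow> nat \<Rightarrow> ('c, 'f, 'p) fm \<Rightarrow> bool" where
  "free_for t x (Pred P ts) \<longleftrightarrow> True"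
| "free_for t x (UnOp k \<phi>) \<longleftrightarrow> free_for t x \<phi>"
| "free_for t x (BinOp k \<phi> \<psi>) \<longleftrightarrow> free_for t x \<phi> \<and> free_for t x \<psi>"
| "free_for t x (Quant q z \<phi>) \<longleftrightarrow>
     x \<notin> free_vars (Quant q z \<phi>) \<or> (z \<notin> tm_vars t \<and> free_for t x \<phi>)"

text \<open>\<open>part_repl x y \<phi> \<phi>'\<close>: \<open>\<phi>'\<close> arises from \<open>\<phi>\<close> by replacing some (possibly none, possibly all)
  free occurrences of \<open>x\<close> by \<open>y\<close>.\<close>

inductive tm_part_repl :: "nat \<Rightarrow> nat \<Rightarrow> ('c, 'f) tm \<Rightarrow> ('c, 'f) tm \<Rightarrow> bool" for x y where
  "tm_part_repl x y t t"
| "tm_part_repl x y (Var x) (Var y)"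
| "list_all2 (tm_part_repl x y) ts ts' \<Longrightarrow> tm_part_repl x y (Fun f ts) (Fun f ts')"

inductive part_repl :: "nat \<Rightarrow> nat \<Rightarrow> ('c, 'f, 'p) fm \<Rightarrow> ('c, 'f, 'p) fm \<Rightarrow> bool" for x y where
  "list_all2 (tm_part_repl x y) ts ts' \<Longrightarrow> part_repl x y (Pred P ts) (Pred P ts')"
| "part_repl x y \<phi> \<phi>' \<Longrightarrow> part_repl x y (UnOp k \<phi>) (UnOp k \<phi>')"
| "part_repl x y \<phi> \<phi>' \<Longrightarrow> part_repl x y \<psi> \<psi>' \<Longrightarrow> part_repl x y (BinOp k \<phi> \<psi>) (BinOp k \<phi>' \<psi>')"
| "part_repl x y (Quant q x \<phi>) (Quant q x \<phi>)"
| "z \<noteq> x \<Longrightarrow> part_repl x y \<phi> \<phi>' \<Longrightarrow> part_repl x y (Quant q z \<phi>) (Quant q z \<phi>')"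

text \<open>Variants: the congruence generated by deletion of void quantifiers and capture-free renaming
  of a bound variable.\<close>

inductive variant :: "('c, 'f, 'p) fm \<Rightarrow> ('c, 'f, 'p) fm \<Rightarrow> bool" where
  void: "x \<notin> free_vars \<phi> \<Longrightarrow> variant (Quant q x \<phi>) \<phi>"
| rename: "y \<notin> free_vars \<phi> \<Longrightarrow> free_for (Var y) x \<phi> \<Longrightarrow>
    variant (Quant q x \<phi>) (Quant q y (\<phi>[x \<^bold>/ Var y]))"
| refl: "variant \<phi> \<phi>"
| sym: "variant \<phi> \<psi> \<Longrightarrow> variant \<psi> \<phi>"
| trans: "variant \<phi> \<psi> \<Longrightarrow> variant \<psi> \<chi> \<Longrightarrow> variant \<phi> \<chi>"
| UnOp: "variant \<phi> \<phi>' \<Longrightarrow> variant (UnOp k \<phi>) (UnOp k \<phi>')"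
| BinOp: "variant \<phi> \<phi>' \<Longrightarrow> variant \<psi> \<psi>' \<Longrightarrow> variant (BinOp k \<phi> \<psi>) (BinOp k \<phi>' \<psi>')"
| Quant: "variant \<phi> \<phi>' \<Longrightarrow> variant (Quant q x \<phi>) (Quant q x \<phi>')"


section \<open>The Hilbert calculus\<close>

text \<open>The schemas are stated for raw formulas; \<open>derivation\<close> restricts every step, hence every
  axiom instance used, to the language. In \<open>Ax12\<close> and \<open>Ax13\<close> this forces \<open>t\<close> to be a term of the
  language, unless \<open>x\<close> is not free in \<open>\<phi>\<close>, in which case the instance does not depend on \<open>t\<close>.\<close>

inductive axiom :: "('c, 'f, 'p eq_pred) fm \<Rightarrow> bool" where
  A1: "axiom (\<alpha> \<^bold>\<rightarrow> (\<beta> \<^bold>\<rightarrow> \<alpha>))"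
| A2: "axiom ((\<alpha> \<^bold>\<rightarrow> (\<beta> \<^bold>\<rightarrow> \<gamma>)) \<^bold>\<rightarrow> ((\<alpha> \<^bold>\<rightarrow> \<beta>) \<^bold>\<rightarrow> (\<alpha> \<^bold>\<rightarrow> \<gamma>)))"
| A3: "axiom (\<alpha> \<^bold>\<rightarrow> (\<beta> \<^bold>\<rightarrow> (\<alpha> \<^bold>\<and> \<beta>)))"
| A4: "axiom ((\<alpha> \<^bold>\<and> \<beta>) \<^bold>\<rightarrow> \<alpha>)"
| A5: "axiom ((\<alpha> \<^bold>\<and> \<beta>) \<^bold>\<rightarrow> \<beta>)"
| A6: "axiom (\<alpha> \<^bold>\<rightarrow> (\<alpha> \<^bold>\<or> \<beta>))"
| A7: "axiom (\<beta> \<^bold>\<rightarrow> (\<alpha> \<^bold>\<or> \<beta>))"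
| A8: "axiom ((\<alpha> \<^bold>\<rightarrow> \<gamma>) \<^bold>\<rightarrow> ((\<beta> \<^bold>\<rightarrow> \<gamma>) \<^bold>\<rightarrow> ((\<alpha> \<^bold>\<or> \<beta>) \<^bold>\<rightarrow> \<gamma>)))"
| A9: "axiom (\<alpha> \<^bold>\<or> (\<alpha> \<^bold>\<rightarrow> \<beta>))"
| A10: "axiom (\<alpha> \<^bold>\<or> (\<^bold>\<not> \<alpha>))"
| A11: "axiom ((\<^bold>\<circ> \<alpha>) \<^bold>\<rightarrow> (\<alpha> \<^bold>\<rightarrow> ((\<^bold>\<not> \<alpha>) \<^bold>\<rightarrow> \<beta>)))"
| Ax12: "free_for t x \<phi> \<Longrightarrow> axiom (\<phi>[x \<^bold>/ t] \<^bold>\<rightarrow> Quant Exists x \<phi>)"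
| Ax13: "free_for t x \<phi> \<Longrightarrow> axiom (Quant Forall x \<phi> \<^bold>\<rightarrow> \<phi>[x \<^bold>/ t])"
| Ax14: "variant \<alpha> \<beta> \<Longrightarrow> axiom (\<alpha> \<^bold>\<rightarrow> \<beta>)"
| AxEq1: "axiom (Quant Forall x (Var x \<^bold>\<approx> Var x))"
| AxEq2: "free_for (Var y) x \<phi> \<Longrightarrow> part_repl x y \<phi> \<phi>' \<Longrightarrow>
    axiom ((Var x \<^bold>\<approx> Var y) \<^bold>\<rightarrow> (\<phi> \<^bold>\<rightarrow> \<phi>'))"

inductive rule :: "('c, 'f, 'p) fm set \<Rightarrow> ('c, 'f, 'p) fm \<Rightarrow> bool" where
  MP: "rule {\<alpha>, \<alpha> \<^bold>\<rightarrow> \<beta>} \<beta>"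
| Ex_In: "x \<notin> free_vars \<psi> \<Longrightarrow> rule {\<phi> \<^bold>\<rightarrow> \<psi>} (Quant Exists x \<phi> \<^bold>\<rightarrow> \<psi>)"
| All_In: "x \<notin> free_vars \<phi> \<Longrightarrow> rule {\<phi> \<^bold>\<rightarrow> \<psi>} (\<phi> \<^bold>\<rightarrow> Quant Forall x \<psi>)"

definition derivation ::
    "('c, 'f, 'p) signature \<Rightarrow> ('c, 'f, 'p eq_pred) fm set \<Rightarrow> ('c, 'f, 'p eq_pred) fm list \<Rightarrow> bool" where
  "derivation \<Theta> \<Gamma> ds \<longleftrightarrow>
     set ds \<subseteq> For (eq_sig \<Theta>) \<and>
     (\<forall>i < length ds. axiom (ds ! i) \<or> ds ! i \<in> \<Gamma> \<or> (\<exists>Ps \<subseteq> set (take i ds). rule Ps (ds ! i)))"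

definition derives ::
    "('c, 'f, 'p) signature \<Rightarrow> ('c, 'f, 'p eq_pred) fm set \<Rightarrow> ('c, 'f, 'p eq_pred) fm \<Rightarrow> bool" where
  "derives \<Theta> \<Gamma> \<phi> \<longleftrightarrow> (\<exists>ds. derivation \<Theta> \<Gamma> ds \<and> ds \<noteq> [] \<and> last ds = \<phi>)"


section \<open>Swap structures\<close>

text \<open>Complete Boolean algebras are types of sort \<open>{boolean_algebra, complete_lattice}\<close>. The class
  \<open>complete_boolean_algebra\<close> is not suitable: it requires complete distributivity, which
  (classically) leaves only the atomic algebras.\<close>

type_synonym 'b triple = "'b \<times> 'b \<times> 'b"

fun pr1 :: "'b triple \<Rightarrow> 'b" where "pr1 (a, b, c) = a"
fun pr2 :: "'b triple \<Rightarrow> 'b" where "pr2 (a, b, c) = b"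
fun pr3 :: "'b triple \<Rightarrow> 'b" where "pr3 (a, b, c) = c"

fun ba_bin :: "binop \<Rightarrow> 'b \<Rightarrow> 'b \<Rightarrow> 'b::boolean_algebra" where
  "ba_bin And a b = inf a b"
| "ba_bin Or a b = sup a b"
| "ba_bin Imp a b = sup (- a) b"

fun swap_proj :: "unop \<Rightarrow> 'b triple \<Rightarrow> 'b" where
  "swap_proj Neg x = pr2 x"
| "swap_proj Circ x = pr3 x"

definition swap_universe :: "'b::boolean_algebra triple set" where
  "swap_universe = {x. sup (pr1 x) (pr2 x) = top \<and> inf (inf (pr1 x) (pr2 x)) (pr3 x) = bot}"

record 'b swap =
  carrier :: "'b triple set"
  bin_op :: "binop \<Rightarrow> 'b triple \<Rightarrow> 'b triple \<Rightarrow> 'b triple set"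
  un_op :: "unop \<Rightarrow> 'b triple \<Rightarrow> 'b triple set"

definition swap_structure :: "'b::boolean_algebra swap \<Rightarrow> bool" where
  "swap_structure \<B> \<longleftrightarrow>
     carrier \<B> \<noteq> {} \<and> carrier \<B> \<subseteq> swap_universe \<and>
     (\<forall>k. \<forall>x \<in> carrier \<B>. \<forall>y \<in> carrier \<B>.
        bin_op \<B> k x y \<noteq> {} \<and>
        bin_op \<B> k x y \<subseteq> {z \<in> carrier \<B>. pr1 z = ba_bin k (pr1 x) (pr1 y)}) \<and>
     (\<forall>k. \<forall>x \<in> carrier \<B>.
        un_op \<B> k x \<noteq> {} \<and>
        un_op \<B> k x \<subseteq> {z \<in> carrier \<B>. pr1 z = swap_proj k x})"

definition designated :: "'b::boolean_algebra swap \<Rightarrow> 'b triple set" where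
  "designated \<B> = {x \<in> carrier \<B>. pr1 x = top}"


section \<open>Structures and valuations\<close>

record ('c, 'f, 'p, 'u, 'b) struct =
  dom :: "'u set"
  const_int :: "'c \<Rightarrow> 'u"
  fun_int :: "'f \<Rightarrow> 'u list \<Rightarrow> 'u"
  pred_int :: "'p \<Rightarrow> 'u list \<Rightarrow> 'b triple"

definition is_structure ::
    "('c, 'f, 'p) signature \<Rightarrow> 'b swap \<Rightarrow> ('c, 'f, 'p, 'u, 'b) struct \<Rightarrow> bool" where
  "is_structure \<Xi> \<B> \<AA> \<longleftrightarrow>
     dom \<AA> \<noteq> {} \<and>
     (\<forall>c \<in> csyms \<Xi>. const_int \<AA> c \<in> dom \<AA>) \<and>
     (\<forall>n \<ge> 1. \<forall>f \<in> fsyms \<Xi> n. \<forall>us. length us = n \<and> set us \<subseteq> dom \<AA> \<longrightarrow>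
        fun_int \<AA> f us \<in> dom \<AA>) \<and>
     (\<forall>n \<ge> 1. \<forall>P \<in> psyms \<Xi> n. \<forall>us. length us = n \<and> set us \<subseteq> dom \<AA> \<longrightarrow>
        pred_int \<AA> P us \<in> carrier \<B>)"

definition standard_equality ::
    "'b::boolean_algebra swap \<Rightarrow> ('c, 'f, 'p eq_pred, 'u, 'b) struct \<Rightarrow> bool" where
  "standard_equality \<B> \<AA> \<longleftrightarrow>
     (\<forall>a \<in> dom \<AA>. \<forall>b \<in> dom \<AA>. pred_int \<AA> Eq [a, b] \<in> designated \<B> \<longleftrightarrow> a = b)"

text \<open>Diagram language: \<open>Name a\<close> is the new constant naming the individual \<open>a\<close>.\<close>

datatype ('c, 'u) dconst = Old 'c | Name 'u

definition diag_sig :: "('c, 'f, 'p) signature \<Rightarrow> 'u set \<Rightarrow> (('c, 'u) dconst, 'f, 'p) signature" where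
  "diag_sig \<Xi> U = \<lparr>csyms = Old ` csyms \<Xi> \<union> Name ` U, fsyms = fsyms \<Xi>, psyms = psyms \<Xi>\<rparr>"

definition diag_struct ::
    "('c, 'f, 'p, 'u, 'b) struct \<Rightarrow> (('c, 'u) dconst, 'f, 'p, 'u, 'b) struct" where
  "diag_struct \<AA> = \<lparr>dom = dom \<AA>,
     const_int = (\<lambda>d. case d of Old c \<Rightarrow> const_int \<AA> c | Name a \<Rightarrow> a),
     fun_int = fun_int \<AA>, pred_int = pred_int \<AA>\<rparr>"

abbreviation nm :: "'u \<Rightarrow> (('c, 'u) dconst, 'f) tm" where
  "nm a \<equiv> Cnst (Name a)"

abbreviation lift_fm :: "('c, 'f, 'p) fm \<Rightarrow> (('c, 'u) dconst, 'f, 'p) fm" where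
  "lift_fm \<equiv> map_fm Old id id"

definition assignments :: "('c, 'f, 'p, 'u, 'b) struct \<Rightarrow> (nat \<Rightarrow> 'u) set" where
  "assignments \<AA> = {\<mu>. \<forall>x. \<mu> x \<in> dom \<AA>}"

fun tm_val :: "('c, 'f, 'p, 'u, 'b) struct \<Rightarrow> (nat \<Rightarrow> 'u) \<Rightarrow> ('c, 'f) tm \<Rightarrow> 'u" where
  "tm_val \<AA> \<mu> (Var x) = \<mu> x"
| "tm_val \<AA> \<mu> (Cnst c) = const_int \<AA> c"
| "tm_val \<AA> \<mu> (Fun f ts) = fun_int \<AA> f (map (tm_val \<AA> \<mu>) ts)"

definition close :: "(nat \<Rightarrow> 'u) \<Rightarrow> (('c, 'u) dconst, 'f, 'p) fm \<Rightarrow> (('c, 'u) dconst, 'f, 'p) fm" where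
  "close \<mu> \<phi> = subst (\<lambda>x. nm (\<mu> x)) \<phi>"

text \<open>The terms of an atomic sentence are closed, so their value is the same under every
  assignment. A valuation is a map on sentences only; its values elsewhere are irrelevant.\<close>

definition QmbC_valuation ::
    "('c, 'f, 'p) signature \<Rightarrow> 'b::{boolean_algebra, complete_lattice} swap \<Rightarrow>
     ('c, 'f, 'p, 'u, 'b) struct \<Rightarrow> ((('c, 'u) dconst, 'f, 'p) fm \<Rightarrow> 'b triple) \<Rightarrow> bool" where
  "QmbC_valuation \<Xi> \<B> \<AA> v \<longleftrightarrow>
    (let \<Xi>U = diag_sig \<Xi> (dom \<AA>); val = tm_val (diag_struct \<AA>) in
     (\<forall>\<phi> \<in> Sen \<Xi>U. v \<phi> \<in> carrier \<B>) \<and>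
     (\<forall>P ts. \<forall>\<mu> \<in> assignments \<AA>. Pred P ts \<in> Sen \<Xi>U \<longrightarrow>
        v (Pred P ts) = pred_int \<AA> P (map (val \<mu>) ts)) \<and>
     (\<forall>k. \<forall>\<phi> \<in> Sen \<Xi>U. v (UnOp k \<phi>) \<in> un_op \<B> k (v \<phi>)) \<and>
     (\<forall>k. \<forall>\<phi> \<in> Sen \<Xi>U. \<forall>\<psi> \<in> Sen \<Xi>U. v (BinOp k \<phi> \<psi>) \<in> bin_op \<B> k (v \<phi>) (v \<psi>)) \<and>
     (\<forall>x \<phi>. Quant Forall x \<phi> \<in> Sen \<Xi>U \<longrightarrow>
        pr1 (v (Quant Forall x \<phi>)) = (INF a \<in> dom \<AA>. pr1 (v (\<phi>[x \<^bold>/ nm a])))) \<and>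
     (\<forall>x \<phi>. Quant Exists x \<phi> \<in> Sen \<Xi>U \<longrightarrow>
        pr1 (v (Quant Exists x \<phi>)) = (SUP a \<in> dom \<AA>. pr1 (v (\<phi>[x \<^bold>/ nm a])))) \<and>
     (\<forall>k z b. \<forall>\<phi> \<in> For \<Xi>U. \<forall>t \<in> Ter \<Xi>U. \<forall>\<mu> \<in> assignments \<AA>.
        free_for t z \<phi> \<and> b = val \<mu> t \<and>
        v (close \<mu> (\<phi>[z \<^bold>/ t])) = v (close \<mu> (\<phi>[z \<^bold>/ nm b])) \<longrightarrow>
        v (close \<mu> ((UnOp k \<phi>)[z \<^bold>/ t])) = v (close \<mu> ((UnOp k \<phi>)[z \<^bold>/ nm b]))) \<and>
     (\<forall>k z b. \<forall>\<phi> \<in> For \<Xi>U. \<forall>\<psi> \<in> For \<Xi>U. \<forall>t \<in> Ter \<Xi>U. \<forall>\<mu> \<in> assignments \<AA>.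
        free_for t z \<phi> \<and> free_for t z \<psi> \<and> b = val \<mu> t \<and>
        v (close \<mu> (\<phi>[z \<^bold>/ t])) = v (close \<mu> (\<phi>[z \<^bold>/ nm b])) \<and>
        v (close \<mu> (\<psi>[z \<^bold>/ t])) = v (close \<mu> (\<psi>[z \<^bold>/ nm b])) \<longrightarrow>
        v (close \<mu> ((BinOp k \<phi> \<psi>)[z \<^bold>/ t])) = v (close \<mu> ((BinOp k \<phi> \<psi>)[z \<^bold>/ nm b]))) \<and>
     (\<forall>q x z b. \<forall>\<phi> \<in> For \<Xi>U. \<forall>t \<in> Ter \<Xi>U. \<forall>\<mu> \<in> assignments \<AA>.
        free_for t z \<phi> \<and> b = val \<mu> t \<and> x \<noteq> z \<and> x \<notin> tm_vars t \<and>
        (\<forall>a \<in> dom \<AA>. v (close (\<mu>(x := a)) (\<phi>[z \<^bold>/ t])) = v (close (\<mu>(x := a)) (\<phi>[z \<^bold>/ nm b]))) \<longrightarrow>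
        v (close \<mu> ((Quant q x \<phi>)[z \<^bold>/ t])) = v (close \<mu> ((Quant q x \<phi>)[z \<^bold>/ nm b]))) \<and>
     (\<forall>\<phi> \<in> Sen \<Xi>U. \<forall>\<phi>' \<in> Sen \<Xi>U. variant \<phi> \<phi>' \<longrightarrow> v \<phi> = v \<phi>'))"

definition QmbC_eq_valuation ::
    "('c, 'f, 'p) signature \<Rightarrow> 'b::{boolean_algebra, complete_lattice} swap \<Rightarrow>
     ('c, 'f, 'p eq_pred, 'u, 'b) struct \<Rightarrow>
     ((('c, 'u) dconst, 'f, 'p eq_pred) fm \<Rightarrow> 'b triple) \<Rightarrow> bool" where
  "QmbC_eq_valuation \<Theta> \<B> \<AA> v \<longleftrightarrow>
     QmbC_valuation (eq_sig \<Theta>) \<B> \<AA> v \<and>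
     (\<forall>x y \<phi>'. \<forall>\<phi> \<in> For (diag_sig (eq_sig \<Theta>) (dom \<AA>)). \<forall>\<mu> \<in> assignments \<AA>.
        free_for (Var y) x \<phi> \<and> part_repl x y \<phi> \<phi>' \<longrightarrow>
        v (close \<mu> ((Var x \<^bold>\<approx> Var y) \<^bold>\<rightarrow> (\<phi> \<^bold>\<rightarrow> \<phi>'))) \<in> designated \<B>)"


section \<open>Semantical consequence\<close>

definition consequence_in ::
    "('c, 'f, 'p) signature \<Rightarrow> 'b::{boolean_algebra, complete_lattice} swap \<Rightarrow>
     ('c, 'f, 'p eq_pred, 'u, 'b) struct \<Rightarrow>
     ('c, 'f, 'p eq_pred) fm set \<Rightarrow> ('c, 'f, 'p eq_pred) fm \<Rightarrow> bool" where
  "consequence_in \<Theta> \<B> \<AA> \<Gamma> \<phi> \<longleftrightarrow>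
     (\<forall>v. QmbC_eq_valuation \<Theta> \<B> \<AA> v \<longrightarrow>
        (\<forall>\<gamma> \<in> \<Gamma>. \<forall>\<mu> \<in> assignments \<AA>. v (close \<mu> (lift_fm \<gamma>)) \<in> designated \<B>) \<longrightarrow>
        (\<forall>\<mu> \<in> assignments \<AA>. v (close \<mu> (lift_fm \<phi>)) \<in> designated \<B>))"

text \<open>A HOL definition cannot quantify over types, so the type \<open>'b\<close> of the complete Boolean algebra
  and the type \<open>'u\<close> containing the domains are parameters. In a theorem about \<open>entails\<close> that leaves
  them as type variables they are universally quantified.\<close>

definition entails ::
    "'b::{boolean_algebra, complete_lattice} itself \<Rightarrow> 'u itself \<Rightarrow> ('c, 'f, 'p) signature \<Rightarrow>
     ('c, 'f, 'p eq_pred) fm set \<Rightarrow> ('c, 'f, 'p eq_pred) fm \<Rightarrow> bool" where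
  "entails _ _ \<Theta> \<Gamma> \<phi> \<longleftrightarrow>
     (\<forall>(\<B> :: 'b swap) (\<AA> :: ('c, 'f, 'p eq_pred, 'u, 'b) struct).
        swap_structure \<B> \<and> is_structure (eq_sig \<Theta>) \<B> \<AA> \<and> standard_equality \<B> \<AA> \<longrightarrow>
        consequence_in \<Theta> \<B> \<AA> \<Gamma> \<phi>)"

end

theory Submission
  imports Defs
begin

text \<open>An implication between formulas is designated exactly when the first coordinates of the two
  values are ordered in the Boolean algebra, so every axiom and rule reduces to an inequality between
  first coordinates. The instantiation axioms need that substituting a term and substituting
  the name of its value give the same value. Axiom instances
  are carried over to the diagram language, where the schemas, being raw, are still axioms.\<close>

section \<open>Substitution\<close>

lemma tm_subst_cong: "(\<And>x. x \<in> tm_vars t \<Longrightarrow> \<sigma> x = \<tau> x) \<Longrightarrow> tm_subst \<sigma> t = tm_subst \<tau> t"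
  by (induction t) auto

lemma subst_cong: "(\<And>x. x \<in> free_vars \<phi> \<Longrightarrow> \<sigma> x = \<tau> x) \<Longrightarrow> subst \<sigma> \<phi> = subst \<tau> \<phi>"
proof (induction \<phi> arbitrary: \<sigma> \<tau>)
  case (Pred P ts)
  then show ?case by (auto intro!: tm_subst_cong)
next
  case (UnOp u \<phi>)
  have "subst \<sigma> \<phi> = subst \<tau> \<phi>"
    by (rule UnOp.IH) (use UnOp.prems in auto)
  then show ?case by simp
next
  case (BinOp k \<phi> \<psi>)
  have "subst \<sigma> \<phi> = subst \<tau> \<phi>" "subst \<sigma> \<psi> = subst \<tau> \<psi>"
    by (rule BinOp.IH; use BinOp.prems in auto)+
  then show ?case by simp
next
  case (Quant q z \<phi>)
  have "subst (\<sigma>(z := Var z)) \<phi> = subst (\<tau>(z := Var z)) \<phi>"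
    by (rule Quant.IH) (use Quant.prems in auto)
  then show ?case by simp
qed

lemma tm_subst_Var [simp]: "tm_subst Var t = t"
  by (induction t) (auto simp: map_idI)

lemma subst_Var [simp]: "subst Var \<phi> = \<phi>"
  by (induction \<phi>) (auto simp: map_idI)

lemma subst1_not_free: "x \<notin> free_vars \<phi> \<Longrightarrow> \<phi>[x \<^bold>/ t] = \<phi>"
  unfolding subst1_def by (metis fun_upd_other subst_Var subst_cong)

lemma tm_subst_tm_subst: "tm_subst \<sigma> (tm_subst \<tau> t) = tm_subst (\<lambda>x. tm_subst \<sigma> (\<tau> x)) t"
  by (induction t) auto

text \<open>A binder \<open>z\<close> above a free \<open>x\<close> does not occur in
  \<open>t\<close>, so resetting \<open>\<sigma>\<close> at \<open>z\<close> leaves the image of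
  \<open>t\<close> unchanged. Where \<open>x\<close> is not free, both sides ignore
  \<open>t\<close>. Captures caused by \<open>\<sigma>\<close> itself are the same on both
  sides.\<close>

lemma subst_subst1:
  "free_for t x \<phi> \<Longrightarrow> subst \<sigma> (\<phi>[x \<^bold>/ t]) = subst (\<sigma>(x := tm_subst \<sigma> t)) \<phi>"
proof (induction \<phi> arbitrary: \<sigma>)
  case (Pred P ts)
  then show ?case
    by (auto simp: subst1_def tm_subst_tm_subst intro!: tm_subst_cong)
next
  case (Quant q z \<phi>)
  show ?case
  proof (cases "x \<in> free_vars (Quant q z \<phi>)")
    case False
    show ?thesis
      unfolding subst1_not_free[OF False] by (rule subst_cong) (use False in auto)
  next
    case True
    then have zx: "z \<noteq> x" and zt: "z \<notin> tm_vars t" and ff: "free_for t x \<phi>"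
      using Quant.prems by auto
    have "tm_subst (\<sigma>(z := Var z)) t = tm_subst \<sigma> t"
      by (rule tm_subst_cong) (use zt in auto)
    moreover have "Var(x := t, z := Var z) = Var(x := t)"
      using zx by auto
    ultimately show ?thesis
      using Quant.IH[OF ff, of "\<sigma>(z := Var z)"] fun_upd_twist[OF zx[symmetric], of \<sigma>]
      by (simp add: subst1_def del: fun_upd_apply)
  qed
qed (auto simp: subst1_def)

text \<open>Below a binder, closing by names becomes a substitution that keeps the bound variable.
  This class contains the closing maps and is stable under that reset, and its closed images cannot
  be captured, so inductions over formulas go through.\<close>

definition partial_closing :: "(nat \<Rightarrow> ('c, 'f) tm) \<Rightarrow> bool" where
  "partial_closing \<sigma> \<longleftrightarrow> (\<forall>x. \<sigma> x = Var x \<or> tm_vars (\<sigma> x) = {})"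

lemma partial_closing_upd [simp]: "partial_closing \<sigma> \<Longrightarrow> partial_closing (\<sigma>(x := Var x))"
  by (auto simp: partial_closing_def)

lemma partial_closing_nm [simp]: "partial_closing (\<lambda>x. nm (\<mu> x))"
  by (auto simp: partial_closing_def)

lemma tm_subst_closed: "tm_vars t = {} \<Longrightarrow> tm_subst \<sigma> t = t"
  using tm_subst_cong[of t \<sigma> Var] by simp

text \<open>Closed images of \<open>\<sigma>\<close> are untouched by the second substitution, and
  \<open>x\<close>, which \<open>\<sigma>\<close> keeps, meets \<open>t\<close> under the same
  binders on both sides.\<close>

lemma subst1_subst:
  assumes "partial_closing \<sigma>" "\<sigma> x = Var x"
  shows "(subst \<sigma> \<phi>)[x \<^bold>/ t] = subst (\<sigma>(x := t)) \<phi>"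
  using assms
proof (induction \<phi> arbitrary: \<sigma>)
  case (Pred P ts)
  have "tm_subst (Var(x := t)) (\<sigma> y) = (\<sigma>(x := t)) y" for y
  proof (cases "y = x")
    case False
    then show ?thesis
      using Pred.prems tm_subst_closed[of "\<sigma> y"]
      by (auto simp: partial_closing_def) (metis fun_upd_other tm_subst.simps(1))
  qed (use Pred.prems in auto)
  then show ?case
    by (auto simp: subst1_def tm_subst_tm_subst intro!: tm_subst_cong)
next
  case (Quant q z \<phi>)
  show ?case
  proof (cases "z = x")
    case True
    have "(\<sigma>(x := t))(x := Var x) = \<sigma>(x := Var x)" by simp
    with True show ?thesis by (simp add: subst1_def del: fun_upd_apply)
  next
    case False
    then have "Var(x := t, z := Var z) = Var(x := t)" "(\<sigma>(z := Var z)) x = Var x"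
      "partial_closing (\<sigma>(z := Var z))"
      using Quant.prems by auto
    then show ?thesis
      using Quant.IH[of "\<sigma>(z := Var z)"] fun_upd_twist[OF False, of \<sigma>]
      by (simp add: subst1_def del: fun_upd_apply)
  qed
qed (auto simp: subst1_def)

lemma tm_vars_tm_subst: "tm_vars (tm_subst \<sigma> t) = (\<Union>x\<in>tm_vars t. tm_vars (\<sigma> x))"
  by (induction t) auto

lemma free_vars_subst:
  "partial_closing \<sigma> \<Longrightarrow> free_vars (subst \<sigma> \<phi>) \<subseteq> {x \<in> free_vars \<phi>. tm_vars (\<sigma> x) \<noteq> {}}"
proof (induction \<phi> arbitrary: \<sigma>)
  case (Pred P ts)
  then have "tm_vars (\<sigma> x) \<subseteq> {x}" for x
    by (auto simp: partial_closing_def) (metis empty_iff singletonD tm_vars.simps(1))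
  then show ?case by (fastforce simp: tm_vars_tm_subst)
next
  case (BinOp k \<phi> \<psi>)
  then show ?case by (simp; blast)
next
  case (Quant q z \<phi>)
  have "free_vars (subst (\<sigma>(z := Var z)) \<phi>) \<subseteq> {x \<in> free_vars \<phi>. tm_vars ((\<sigma>(z := Var z)) x) \<noteq> {}}"
    by (rule Quant.IH) (rule partial_closing_upd[OF Quant.prems])
  then show ?case by (auto split: if_splits)
qed simp_all

lemma free_vars_close [simp]: "free_vars (close \<mu> \<phi>) = {}"
  using free_vars_subst[of "\<lambda>x. nm (\<mu> x)" \<phi>] by (simp add: close_def)

lemma free_for_subst:
  "partial_closing \<sigma> \<Longrightarrow> free_for t x \<phi> \<Longrightarrow> free_for t x (subst \<sigma> \<phi>)"
proof (induction \<phi> arbitrary: \<sigma>)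
  case (Quant q z \<phi>)
  have pc: "partial_closing (\<sigma>(z := Var z))"
    using Quant.prems by simp
  show ?case
    using Quant.prems Quant.IH[OF pc] free_vars_subst[OF pc, of \<phi>]
    by (auto simp del: fun_upd_apply)
qed auto

text \<open>Needed for \<open>Ax14\<close>: its instances may be open, whereas valuations respect
  variants only between sentences. Partial closings rather than full ones let the induction pass the
  quantifier case.\<close>

lemma variant_subst: "variant \<phi> \<psi> \<Longrightarrow> partial_closing \<sigma> \<Longrightarrow> variant (subst \<sigma> \<phi>) (subst \<sigma> \<psi>)"
proof (induction arbitrary: \<sigma> rule: variant.induct)
  case (void x \<phi> q)
  have "subst (\<sigma>(x := Var x)) \<phi> = subst \<sigma> \<phi>"
    by (rule subst_cong) (use void.hyps in auto)
  moreover have "x \<notin> free_vars (subst \<sigma> \<phi>)"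
    using free_vars_subst void by blast
  ultimately show ?case by (simp add: variant.void)
next
  case (rename y \<phi> x q)
  let ?\<phi> = "subst (\<sigma>(x := Var x)) \<phi>"
  have pc: "partial_closing (\<sigma>(x := Var x))"
    using rename.prems by simp
  \<comment> \<open>Both orders replace \<open>x\<close> by \<open>y\<close> and the other variables
    by \<open>\<sigma>\<close>; keeping \<open>y\<close> open makes no difference because
    \<open>y\<close> is not free in \<open>\<phi>\<close>.\<close>
  have "subst (\<sigma>(y := Var y)) (\<phi>[x \<^bold>/ Var y]) = subst (\<sigma>(y := Var y, x := Var y)) \<phi>"
    using subst_subst1[OF rename.hyps(2), of "\<sigma>(y := Var y)"] by simp
  also have "\<dots> = subst (\<sigma>(x := Var y)) \<phi>"
    by (rule subst_cong) (use rename.hyps(1) in auto)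
  also have "\<dots> = ?\<phi>[x \<^bold>/ Var y]"
    using subst1_subst[OF pc, of x \<phi> "Var y"] by simp
  finally have eq: "subst (\<sigma>(y := Var y)) (\<phi>[x \<^bold>/ Var y]) = ?\<phi>[x \<^bold>/ Var y]" .
  have "variant (Quant q x ?\<phi>) (Quant q y (?\<phi>[x \<^bold>/ Var y]))"
    by (rule variant.rename)
      (use free_vars_subst[OF pc, of \<phi>] free_for_subst[OF pc] rename.hyps in auto)
  with eq show ?case by simp
next
  case (trans \<phi> \<psi> \<chi>)
  then show ?case by (meson variant.trans)
next
  case (sym \<phi> \<psi>)
  then show ?case by (meson variant.sym)
qed (auto intro: variant.void variant.rename variant.refl variant.UnOp variant.BinOp variant.Quant)

section \<open>Languages and lifting\<close>

lemma Ter_simps [simp]: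
  "Var x \<in> Ter \<Xi>"
  "Cnst c \<in> Ter \<Xi> \<longleftrightarrow> c \<in> csyms \<Xi>"
  "Fun f ts \<in> Ter \<Xi> \<longleftrightarrow> ts \<noteq> [] \<and> f \<in> fsyms \<Xi> (length ts) \<and> set ts \<subseteq> Ter \<Xi>"
  by (auto simp: Suc_le_eq intro!: Ter.intros elim: Ter.cases)

lemma For_simps [simp]:
  "Pred P ts \<in> For \<Xi> \<longleftrightarrow> ts \<noteq> [] \<and> P \<in> psyms \<Xi> (length ts) \<and> set ts \<subseteq> Ter \<Xi>"
  "UnOp u \<phi> \<in> For \<Xi> \<longleftrightarrow> \<phi> \<in> For \<Xi>"
  "BinOp k \<phi> \<psi> \<in> For \<Xi> \<longleftrightarrow> \<phi> \<in> For \<Xi> \<and> \<psi> \<in> For \<Xi>"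
  "Quant q x \<phi> \<in> For \<Xi> \<longleftrightarrow> \<phi> \<in> For \<Xi>"
  by (auto simp: Suc_le_eq intro!: For.intros elim: For.cases)

lemma tm_subst_Ter: "t \<in> Ter \<Xi> \<Longrightarrow> (\<And>x. \<sigma> x \<in> Ter \<Xi>) \<Longrightarrow> tm_subst \<sigma> t \<in> Ter \<Xi>"
  by (induction t) auto

lemma subst_For: "\<phi> \<in> For \<Xi> \<Longrightarrow> (\<And>x. \<sigma> x \<in> Ter \<Xi>) \<Longrightarrow> subst \<sigma> \<phi> \<in> For \<Xi>"
  by (induction \<phi> arbitrary: \<sigma>) (auto intro!: tm_subst_Ter)

lemma tm_subst_TerD:
  "tm_subst \<sigma> s \<in> Ter \<Xi> \<Longrightarrow> x \<in> tm_vars s \<Longrightarrow> \<sigma> x \<in> Ter \<Xi>"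
  by (induction s) auto

text \<open>Since \<open>axiom\<close> ranges over raw formulas, \<open>Ax12\<close> and
  \<open>Ax13\<close> do not say that \<open>t\<close> is in the language; this is recovered from an
  occurrence of \<open>t\<close> in the substituted formula.\<close>

lemma subst_For_D:
  "subst \<sigma> \<phi> \<in> For \<Xi> \<Longrightarrow> x \<in> free_vars \<phi> \<Longrightarrow> \<sigma> x \<in> Ter \<Xi>"
proof (induction \<phi> arbitrary: \<sigma>)
  case (Pred P ts)
  then show ?case by (auto dest: tm_subst_TerD)
next
  case (Quant q z \<phi>)
  then have "(\<sigma>(z := Var z)) x \<in> Ter \<Xi>"
    by (intro Quant.IH) (auto simp del: fun_upd_apply)
  with Quant.prems show ?case by auto
qed auto

section \<open>Renaming of non-logical symbols\<close>

lemma tm_vars_map_tm [simp]: "tm_vars (map_tm f g t) = tm_vars t"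
  by (induction t) auto

lemma free_vars_map_fm [simp]: "free_vars (map_fm f g h \<phi>) = free_vars \<phi>"
  by (induction \<phi>) auto

lemma map_tm_tm_subst: "map_tm f g (tm_subst \<sigma> t) = tm_subst (map_tm f g \<circ> \<sigma>) (map_tm f g t)"
  by (induction t) auto

lemma map_fm_subst: "map_fm f g h (subst \<sigma> \<phi>) = subst (map_tm f g \<circ> \<sigma>) (map_fm f g h \<phi>)"
proof (induction \<phi> arbitrary: \<sigma>)
  case (Quant q z \<phi>)
  have "map_tm f g \<circ> \<sigma>(z := Var z) = (map_tm f g \<circ> \<sigma>)(z := Var z)"
    by auto
  then show ?case
    using Quant.IH[of "\<sigma>(z := Var z)"] by (simp only: subst.simps fm.map)
qed (auto simp: map_tm_tm_subst)

lemma map_fm_subst1 [simp]: "map_fm f g h (\<phi>[x \<^bold>/ t]) = (map_fm f g h \<phi>)[x \<^bold>/ map_tm f g t]"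
proof -
  have "map_tm f g \<circ> Var(x := t) = Var(x := map_tm f g t)" by auto
  then show ?thesis by (simp add: subst1_def map_fm_subst del: fun_upd_apply)
qed

lemma free_for_map_fm [simp]: "free_for (map_tm f g t) x (map_fm f g h \<phi>) \<longleftrightarrow> free_for t x \<phi>"
  by (induction \<phi>) auto

lemma free_for_Var_map_fm [simp]: "free_for (Var y) x (map_fm f g h \<phi>) \<longleftrightarrow> free_for (Var y) x \<phi>"
  using free_for_map_fm[of f g "Var y"] by simp

lemma tm_part_repl_map_tm:
  "tm_part_repl x y t t' \<Longrightarrow> tm_part_repl x y (map_tm f g t) (map_tm f g t')"
proof (induction rule: tm_part_repl.induct)
  case (3 ts ts' s)
  then have "list_all2 (tm_part_repl x y) (map (map_tm f g) ts) (map (map_tm f g) ts')"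
    by (auto simp: list.rel_map intro: list_all2_mono)
  then show ?case by (simp add: tm_part_repl.intros(3))
qed (simp_all add: tm_part_repl.intros(1,2))

lemma part_repl_map_fm:
  "part_repl x y \<phi> \<phi>' \<Longrightarrow> part_repl x y (map_fm f g h \<phi>) (map_fm f g h \<phi>')"
proof (induction rule: part_repl.induct)
  case (1 ts ts' P)
  then have "list_all2 (tm_part_repl x y) (map (map_tm f g) ts) (map (map_tm f g) ts')"
    by (auto simp: list.rel_map intro: list_all2_mono tm_part_repl_map_tm)
  then show ?case by (simp add: part_repl.intros(1))
qed (simp_all add: part_repl.intros(2-5))

lemma variant_map_fm: "variant \<phi> \<psi> \<Longrightarrow> variant (map_fm f g h \<phi>) (map_fm f g h \<psi>)"
proof (induction rule: variant.induct)
  case (trans \<phi> \<psi> \<chi>)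
  then show ?case by (meson variant.trans)
next
  case (sym \<phi> \<psi>)
  then show ?case by (meson variant.sym)
qed (auto intro: variant.void variant.rename variant.refl variant.UnOp variant.BinOp variant.Quant)

text \<open>The schemas and their side conditions mention only variables, connectives, quantifiers
  and \<open>Eq\<close>, so they survive any renaming of symbols that fixes
  \<open>Eq\<close>.\<close>

lemma axiom_map_fm: "axiom \<phi> \<Longrightarrow> h Eq = Eq \<Longrightarrow> axiom (map_fm f g h \<phi>)"
proof (induction rule: axiom.induct)
  case (Ax14 \<alpha> \<beta>)
  then show ?case by (simp add: axiom.Ax14 variant_map_fm)
next
  case (AxEq2 y x \<phi> \<phi>')
  then show ?case by (simp add: axiom.AxEq2 part_repl_map_fm)
qed (simp_all add: axiom.A1 axiom.A2 axiom.A3 axiom.A4 axiom.A5 axiom.A6 axiom.A7 axiom.A8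
    axiom.A9 axiom.A10 axiom.A11 axiom.Ax12 axiom.Ax13 axiom.AxEq1)

lemma map_tm_Ter:
  assumes "f ` csyms \<Xi> \<subseteq> csyms \<Xi>'" "\<And>n. g ` fsyms \<Xi> n \<subseteq> fsyms \<Xi>' n" "t \<in> Ter \<Xi>"
  shows "map_tm f g t \<in> Ter \<Xi>'"
  using assms(3)
proof (induction t rule: tm.induct)
  case (Fun s ts)
  then show ?case using assms(2)[of "length ts"] by auto
qed (use assms(1) in auto)

lemma map_fm_For:
  assumes "f ` csyms \<Xi> \<subseteq> csyms \<Xi>'" "\<And>n. g ` fsyms \<Xi> n \<subseteq> fsyms \<Xi>' n"
    "\<And>n. h ` psyms \<Xi> n \<subseteq> psyms \<Xi>' n" "\<phi> \<in> For \<Xi>"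
  shows "map_fm f g h \<phi> \<in> For \<Xi>'"
  using assms(4)
proof (induction \<phi> rule: fm.induct)
  case (Pred P ts)
  then show ?case using assms(3)[of "length ts"] map_tm_Ter[OF assms(1,2)] by auto
qed auto

lemma lift_For: "\<phi> \<in> For \<Xi> \<Longrightarrow> lift_fm \<phi> \<in> For (diag_sig \<Xi> U)"
  by (rule map_fm_For) (auto simp: diag_sig_def)

section \<open>Valuations\<close>

lemma tm_val_cong: "(\<And>x. x \<in> tm_vars t \<Longrightarrow> \<mu> x = \<nu> x) \<Longrightarrow> tm_val \<AA> \<mu> t = tm_val \<AA> \<nu> t"
proof (induction t)
  case (Fun f ts)
  then have "map (tm_val \<AA> \<mu>) ts = map (tm_val \<AA> \<nu>) ts"
    by (auto intro!: map_cong)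
  then show ?case by (simp del: map_eq_conv)
qed auto

lemma tm_val_tm_subst: "tm_val \<AA> \<mu> (tm_subst \<sigma> t) = tm_val \<AA> (\<lambda>x. tm_val \<AA> \<mu> (\<sigma> x)) t"
proof (induction t)
  case (Fun f ts)
  then have "map (\<lambda>s. tm_val \<AA> \<mu> (tm_subst \<sigma> s)) ts = map (tm_val \<AA> (\<lambda>x. tm_val \<AA> \<mu> (\<sigma> x))) ts"
    by (auto intro!: map_cong)
  then show ?case by (simp add: comp_def del: map_eq_conv)
qed auto

lemma const_int_Name [simp]: "const_int (diag_struct \<AA>) (Name a) = a"
  by (simp add: diag_struct_def)

lemma close_simps:
  "close \<mu> (UnOp u \<phi>) = UnOp u (close \<mu> \<phi>)"
  "close \<mu> (BinOp k \<phi> \<psi>) = BinOp k (close \<mu> \<phi>) (close \<mu> \<psi>)"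
  "close \<mu> (Pred P ts) = Pred P (map (tm_subst (\<lambda>x. nm (\<mu> x))) ts)"
  by (simp_all add: close_def)

lemma free_for_nm [simp]: "free_for (nm a) x \<phi>"
  by (induction \<phi>) auto

text \<open>A name is closed, hence free for every variable and untouched by the later
  closing.\<close>

lemma close_subst1_nm: "close \<mu> (\<phi>[x \<^bold>/ nm a]) = close (\<mu>(x := a)) \<phi>"
  by (auto simp: close_def subst_subst1 intro!: subst_cong)

lemma close_upd_not_free: "x \<notin> free_vars \<phi> \<Longrightarrow> close (\<mu>(x := a)) \<phi> = close \<mu> \<phi>"
  by (auto simp: close_def intro!: subst_cong)

section \<open>A fixed valuation over an arbitrary signature\<close>

locale swap_valuation =
  fixes \<Xi> :: "('c, 'f, 'p) signature"
    and \<B> :: "'b::{boolean_algebra, complete_lattice} swap"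
    and \<AA> :: "('c, 'f, 'p, 'u, 'b) struct"
    and v :: "(('c, 'u) dconst, 'f, 'p) fm \<Rightarrow> 'b triple"
  assumes swap: "swap_structure \<B>"
    and struct: "is_structure \<Xi> \<B> \<AA>"
    and val: "QmbC_valuation \<Xi> \<B> \<AA> v"
begin

abbreviation "\<Xi>U \<equiv> diag_sig \<Xi> (dom \<AA>)"
abbreviation "tval \<equiv> tm_val (diag_struct \<AA>)"
abbreviation "truth \<mu> \<phi> \<equiv> pr1 (v (close \<mu> \<phi>))"

text \<open>The conjunction defining a valuation is peeled one conjunct at a time: first the range
  condition, then clauses (i) to (vii) in order, with (vi) contributing three.\<close>

lemmas val_clauses = val[unfolded QmbC_valuation_def Let_def]
lemmas v_carrier = val_clauses[THEN conjunct1, rule_format]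
lemmas val_clauses2 = val_clauses[THEN conjunct2]
lemmas v_Pred = val_clauses2[THEN conjunct1, rule_format]
lemmas val_clauses3 = val_clauses2[THEN conjunct2]
lemmas v_UnOp = val_clauses3[THEN conjunct1, rule_format]
lemmas val_clauses4 = val_clauses3[THEN conjunct2]
lemmas v_BinOp = val_clauses4[THEN conjunct1, rule_format]
lemmas val_clauses5 = val_clauses4[THEN conjunct2]
lemmas v_Forall = val_clauses5[THEN conjunct1, rule_format]
lemmas val_clauses6 = val_clauses5[THEN conjunct2]
lemmas v_Exists = val_clauses6[THEN conjunct1, rule_format]
lemmas val_clauses7 = val_clauses6[THEN conjunct2]
lemmas v_cong_UnOp = val_clauses7[THEN conjunct1, rule_format]
lemmas val_clauses8 = val_clauses7[THEN conjunct2]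
lemmas v_cong_BinOp = val_clauses8[THEN conjunct1, rule_format]
lemmas val_clauses9 = val_clauses8[THEN conjunct2]
lemmas v_cong_Quant = val_clauses9[THEN conjunct1, rule_format]
lemmas v_variant = val_clauses9[THEN conjunct2, rule_format]

text \<open>This and the next two are clauses (vi.1) to (vi.3) with \<open>b\<close> instantiated by
  the value of \<open>t\<close>, the shape in which the induction hypotheses of the substitution
  lemma arrive.\<close>

lemma v_subst_UnOp:
  assumes "\<phi> \<in> For \<Xi>U" "t \<in> Ter \<Xi>U" "\<mu> \<in> assignments \<AA>" "free_for t z \<phi>"
    "v (close \<mu> (\<phi>[z \<^bold>/ t])) = v (close \<mu> (\<phi>[z \<^bold>/ nm (tval \<mu> t)]))"
  shows "v (close \<mu> ((UnOp u \<phi>)[z \<^bold>/ t])) = v (close \<mu> ((UnOp u \<phi>)[z \<^bold>/ nm (tval \<mu> t)]))"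
  by (rule v_cong_UnOp) (use assms in auto)

lemma v_subst_BinOp:
  assumes "\<phi> \<in> For \<Xi>U" "\<psi> \<in> For \<Xi>U" "t \<in> Ter \<Xi>U" "\<mu> \<in> assignments \<AA>"
    "free_for t z \<phi>" "free_for t z \<psi>"
    "v (close \<mu> (\<phi>[z \<^bold>/ t])) = v (close \<mu> (\<phi>[z \<^bold>/ nm (tval \<mu> t)]))"
    "v (close \<mu> (\<psi>[z \<^bold>/ t])) = v (close \<mu> (\<psi>[z \<^bold>/ nm (tval \<mu> t)]))"
  shows "v (close \<mu> ((BinOp k \<phi> \<psi>)[z \<^bold>/ t])) = v (close \<mu> ((BinOp k \<phi> \<psi>)[z \<^bold>/ nm (tval \<mu> t)]))"
  by (rule v_cong_BinOp) (use assms in auto)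

lemma v_subst_Quant:
  assumes "\<phi> \<in> For \<Xi>U" "t \<in> Ter \<Xi>U" "\<mu> \<in> assignments \<AA>" "free_for t z \<phi>"
    "x \<noteq> z" "x \<notin> tm_vars t"
    "\<And>a. a \<in> dom \<AA> \<Longrightarrow>
      v (close (\<mu>(x := a)) (\<phi>[z \<^bold>/ t])) = v (close (\<mu>(x := a)) (\<phi>[z \<^bold>/ nm (tval \<mu> t)]))"
  shows "v (close \<mu> ((Quant q x \<phi>)[z \<^bold>/ t])) = v (close \<mu> ((Quant q x \<phi>)[z \<^bold>/ nm (tval \<mu> t)]))"
  by (rule v_cong_Quant) (use assms in auto)

lemma dom_nonempty: "dom \<AA> \<noteq> {}"
  using struct by (simp add: is_structure_def)

lemma assignments_upd: "\<mu> \<in> assignments \<AA> \<Longrightarrow> a \<in> dom \<AA> \<Longrightarrow> \<mu>(x := a) \<in> assignments \<AA>"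
  by (auto simp: assignments_def)

lemma Name_csyms [simp]: "Name a \<in> csyms \<Xi>U \<longleftrightarrow> a \<in> dom \<AA>"
  by (auto simp: diag_sig_def)

lemma close_Sen: "\<phi> \<in> For \<Xi>U \<Longrightarrow> \<mu> \<in> assignments \<AA> \<Longrightarrow> close \<mu> \<phi> \<in> Sen \<Xi>U"
  by (auto simp: Sen_def) (auto simp: close_def assignments_def intro!: subst_For)

lemma tval_dom: "t \<in> Ter \<Xi>U \<Longrightarrow> \<mu> \<in> assignments \<AA> \<Longrightarrow> tval \<mu> t \<in> dom \<AA>"
proof (induction t)
  case (Cnst c)
  then show ?case
    using struct by (auto simp: diag_sig_def diag_struct_def is_structure_def)
next
  case (Fun f ts)
  then have f: "f \<in> fsyms \<Xi> (length ts)" and l: "length ts \<ge> 1"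
    and us: "set (map (tval \<mu>) ts) \<subseteq> dom \<AA>"
    by (auto simp: diag_sig_def Suc_le_eq)
  have "fun_int \<AA> f (map (tval \<mu>) ts) \<in> dom \<AA>"
    using struct f l us unfolding is_structure_def by (metis length_map)
  then show ?case by (simp add: diag_struct_def)
qed (auto simp: assignments_def)

lemma subst1_For: "\<phi> \<in> For \<Xi>U \<Longrightarrow> t \<in> Ter \<Xi>U \<Longrightarrow> \<phi>[x \<^bold>/ t] \<in> For \<Xi>U"
  by (auto simp: subst1_def intro!: subst_For)

text \<open>Nondeterminism of the operations makes this lemma depend on clause (vi), which carries the
  equality of values through each connective and quantifier.\<close>

lemma v_substitution:
  assumes "\<phi> \<in> For \<Xi>U" "t \<in> Ter \<Xi>U" "\<mu> \<in> assignments \<AA>" "free_for t z \<phi>"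
  shows "v (close \<mu> (\<phi>[z \<^bold>/ t])) = v (close \<mu> (\<phi>[z \<^bold>/ nm (tval \<mu> t)]))"
  using assms
proof (induction \<phi> arbitrary: \<mu> rule: fm.induct)
  case (Pred P ts)
  \<comment> \<open>The value of an atom depends only on the values of its terms. Keeping
    \<open>s\<close> arbitrary covers both \<open>t\<close> and the name of its value, which give
    the same updated assignment.\<close>
  have val_eq: "tval \<mu> (tm_subst (\<lambda>x. nm (\<mu> x)) (tm_subst (Var(z := s)) u)) =
      tval (\<mu>(z := tval \<mu> s)) u" for s u
    unfolding tm_val_tm_subst by (rule tm_val_cong) (simp add: tm_val_tm_subst)
  have *: "v (close \<mu> ((Pred P ts)[z \<^bold>/ s])) = pred_int \<AA> P (map (tval (\<mu>(z := tval \<mu> s))) ts)"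
    if "s \<in> Ter \<Xi>U" for s
  proof -
    have "close \<mu> ((Pred P ts)[z \<^bold>/ s]) \<in> Sen \<Xi>U"
      by (intro close_Sen subst1_For that Pred.prems)
    then show ?thesis
      by (simp add: subst1_def close_simps v_Pred[OF Pred.prems(3)] val_eq comp_def)
  qed
  have "nm (tval \<mu> t) \<in> Ter \<Xi>U"
    using tval_dom Pred.prems by simp
  from *[OF this] *[OF Pred.prems(2)] show ?case by simp
next
  case (UnOp u \<phi>)
  then show ?case by (intro v_subst_UnOp) auto
next
  case (BinOp k \<phi> \<psi>)
  then show ?case by (intro v_subst_BinOp) auto
next
  case (Quant q x \<phi>)
  show ?case
  \<comment> \<open>Only when \<open>z\<close> is free in the quantified formula does
    \<open>free_for\<close> keep \<open>x\<close> out of \<open>t\<close>, as clause (vi.3) demands;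
    otherwise both sides are the same formula.\<close>
  proof (cases "z \<in> free_vars (Quant q x \<phi>)")
    case False
    then show ?thesis by (simp only: subst1_not_free[OF False])
  next
    case True
    then have xz: "x \<noteq> z" and xt: "x \<notin> tm_vars t" and ff: "free_for t z \<phi>"
      using Quant.prems by auto
    \<comment> \<open>The induction hypothesis at \<open>\<mu>(x := a)\<close> names the value of
      \<open>t\<close> under that assignment, while clause (vi.3) names its value under
      \<open>\<mu>\<close>; they agree as \<open>x\<close> is not in \<open>t\<close>.\<close>
    have tv: "tval (\<mu>(x := a)) t = tval \<mu> t" for a
      by (rule tm_val_cong) (use xt in auto)
    show ?thesis
    proof (rule v_subst_Quant)
      fix a assume "a \<in> dom \<AA>"
      then have "\<mu>(x := a) \<in> assignments \<AA>"
        by (rule assignments_upd[OF Quant.prems(3)])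
      then have "v (close (\<mu>(x := a)) (\<phi>[z \<^bold>/ t])) =
          v (close (\<mu>(x := a)) (\<phi>[z \<^bold>/ nm (tval (\<mu>(x := a)) t)]))"
        using Quant.prems ff by (intro Quant.IH) (simp_all del: fun_upd_apply)
      then show "v (close (\<mu>(x := a)) (\<phi>[z \<^bold>/ t])) =
          v (close (\<mu>(x := a)) (\<phi>[z \<^bold>/ nm (tval \<mu> t)]))"
        by (simp only: tv)
    qed (use Quant.prems xz xt ff in auto)
  qed
qed

text \<open>A multioperation leaves the full triple open but fixes its first coordinate, so on first
  coordinates the binary connectives are deterministic and Boolean.\<close>

lemma truth_BinOp:
  assumes "\<phi> \<in> For \<Xi>U" "\<psi> \<in> For \<Xi>U" "\<mu> \<in> assignments \<AA>"
  shows "pr1 (v (close \<mu> (BinOp k \<phi> \<psi>))) = ba_bin k (truth \<mu> \<phi>) (truth \<mu> \<psi>)"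
  using v_BinOp[OF close_Sen[OF assms(1,3)] close_Sen[OF assms(2,3)], of k] swap
    v_carrier[OF close_Sen[OF assms(1,3)]] v_carrier[OF close_Sen[OF assms(2,3)]]
  unfolding swap_structure_def close_simps by blast

text \<open>The first coordinate is read off the second or third coordinate of the argument, so the
  whole triple, not just its truth, appears on the right.\<close>

lemma truth_UnOp:
  assumes "\<phi> \<in> For \<Xi>U" "\<mu> \<in> assignments \<AA>"
  shows "pr1 (v (close \<mu> (UnOp u \<phi>))) = swap_proj u (v (close \<mu> \<phi>))"
  using v_UnOp[OF close_Sen[OF assms], of u] swap v_carrier[OF close_Sen[OF assms]]
  unfolding swap_structure_def close_simps by blast

text \<open>The two conditions on triples are what validates \<open>A10\<close> and
  \<open>A11\<close>, respectively.\<close>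

lemma truth_swap_universe:
  assumes "\<phi> \<in> For \<Xi>U" "\<mu> \<in> assignments \<AA>"
  shows "sup (truth \<mu> \<phi>) (pr2 (v (close \<mu> \<phi>))) = top"
    and "inf (inf (truth \<mu> \<phi>) (pr2 (v (close \<mu> \<phi>)))) (pr3 (v (close \<mu> \<phi>))) = bot"
  using v_carrier[OF close_Sen[OF assms]] swap
  unfolding swap_structure_def swap_universe_def by blast+

text \<open>Closing a quantified formula leaves the bound variable open in the body; the name
  inserted by clauses (iv) and (v) completes the closing.\<close>

lemma close_Quant_subst1:
  "(subst ((\<lambda>x. nm (\<mu> x))(x := Var x)) \<phi>)[x \<^bold>/ nm a] = close (\<mu>(x := a)) \<phi>"
proof -
  have "(subst ((\<lambda>x. nm (\<mu> x))(x := Var x)) \<phi>)[x \<^bold>/ nm a] =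
      subst ((\<lambda>x. nm (\<mu> x))(x := Var x, x := nm a)) \<phi>"
    by (rule subst1_subst) simp_all
  also have "\<dots> = close (\<mu>(x := a)) \<phi>"
    unfolding close_def by (rule subst_cong) simp
  finally show ?thesis .
qed

lemma truth_Forall:
  assumes "\<phi> \<in> For \<Xi>U" "\<mu> \<in> assignments \<AA>"
  shows "truth \<mu> (Quant Forall x \<phi>) = (INF a \<in> dom \<AA>. truth (\<mu>(x := a)) \<phi>)"
  using close_Sen[of "Quant Forall x \<phi>" \<mu>] assms
  by (simp add: close_def v_Forall) (simp add: close_Quant_subst1 close_def)

lemma truth_Exists:
  assumes "\<phi> \<in> For \<Xi>U" "\<mu> \<in> assignments \<AA>"
  shows "truth \<mu> (Quant Exists x \<phi>) = (SUP a \<in> dom \<AA>. truth (\<mu>(x := a)) \<phi>)"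
  using close_Sen[of "Quant Exists x \<phi>" \<mu>] assms
  by (simp add: close_def v_Exists) (simp add: close_Quant_subst1 close_def)

lemma designated_iff:
  "\<phi> \<in> For \<Xi>U \<Longrightarrow> \<mu> \<in> assignments \<AA> \<Longrightarrow>
    v (close \<mu> \<phi>) \<in> designated \<B> \<longleftrightarrow> truth \<mu> \<phi> = top"
  using v_carrier close_Sen by (simp add: designated_def)

lemma truth_Imp_iff:
  assumes "\<phi> \<^bold>\<rightarrow> \<psi> \<in> For \<Xi>U" "\<mu> \<in> assignments \<AA>"
  shows "truth \<mu> (\<phi> \<^bold>\<rightarrow> \<psi>) = top \<longleftrightarrow> truth \<mu> \<phi> \<le> truth \<mu> \<psi>"
  using assms by (simp add: truth_BinOp sup_shunt)

text \<open>If \<open>t\<close> lies outside the language then \<open>x\<close> is not free in \<open>\<phi>\<close> and any individual is a witness.\<close>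

lemma truth_subst1_witness:
  assumes "\<phi> \<in> For \<Xi>U" "\<phi>[x \<^bold>/ t] \<in> For \<Xi>U" "\<mu> \<in> assignments \<AA>" "free_for t x \<phi>"
  obtains a where "a \<in> dom \<AA>" "truth \<mu> (\<phi>[x \<^bold>/ t]) = truth (\<mu>(x := a)) \<phi>"
proof (cases "x \<in> free_vars \<phi>")
  case True
  then have t: "t \<in> Ter \<Xi>U"
    using subst_For_D[of "Var(x := t)" \<phi> \<Xi>U x] assms(2) by (simp add: subst1_def)
  show ?thesis
    using that[OF tval_dom[OF t assms(3)]] v_substitution[OF assms(1) t assms(3,4)]
    by (simp add: close_subst1_nm)
next
  case False
  then show ?thesis
    using that dom_nonempty by (auto simp: subst1_not_free close_upd_not_free)
qed

end

section \<open>Soundness of axioms, rules and derivations with equality\<close>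

locale swap_eq_valuation = swap_valuation "eq_sig \<Theta>" \<B> \<AA> v
  for \<Theta> :: "('c, 'f, 'p) signature"
    and \<B> :: "'b::{boolean_algebra, complete_lattice} swap"
    and \<AA> :: "('c, 'f, 'p eq_pred, 'u, 'b) struct"
    and v :: "(('c, 'u) dconst, 'f, 'p eq_pred) fm \<Rightarrow> 'b triple" +
  assumes std: "standard_equality \<B> \<AA>"
    and val_eq: "QmbC_eq_valuation \<Theta> \<B> \<AA> v"
begin

text \<open>The positive schemas become Boolean identities between first coordinates.
  \<open>A10\<close> and \<open>A11\<close> add the conditions on triples, \<open>Ax12\<close> and
  \<open>Ax13\<close> a witness, \<open>Ax14\<close> clause (vii).\<close>

lemma axiom_sound:
  assumes "axiom \<phi>" "\<phi> \<in> For \<Xi>U" and \<mu>: "\<mu> \<in> assignments \<AA>"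
  shows "truth \<mu> \<phi> = top"
  using assms(1,2)
proof (cases rule: axiom.cases)
  case (A2 \<alpha> \<beta> \<gamma>)
  have "sup (- sup (- a) (sup (- b) c)) (sup (- sup (- a) b) (sup (- a) c)) = top" for a b c :: 'b
  proof -
    \<comment> \<open>By distributivity the consequent of \<open>A2\<close> equals its antecedent,
      so the schema evaluates to \<open>sup (- p) p\<close>.\<close>
    have "sup (- sup (- a) b) (sup (- a) c) = sup (- a) (sup (- b) c)"
      by (simp add: sup_inf_distrib1 sup_inf_distrib2 sup.assoc[symmetric]) (simp add: sup_aci)
    then show ?thesis by (simp only: compl_sup_top)
  qed
  with A2 assms show ?thesis by (simp add: truth_BinOp)
next
  case (A3 \<alpha> \<beta>)
  with assms show ?thesis by (simp add: truth_BinOp sup_shunt sup_inf_distrib1)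
next
  case (A8 \<alpha> \<gamma> \<beta>)
  have "sup (- sup (- a) c) (sup (- sup (- b) c) (sup (- sup a b) c)) = top" for a b c :: 'b
  proof -
    \<comment> \<open>The two antecedents of \<open>A8\<close> meet in exactly its final
      implication; currying then finishes.\<close>
    have "inf (sup (- a) c) (sup (- b) c) = sup (- sup a b) c"
      by (simp add: sup_inf_distrib2)
    moreover have "sup (- p) (sup (- q) r) = top" if "inf p q = r" for p q r :: 'b
      by (metis compl_inf compl_sup_top sup.assoc that)
    ultimately show ?thesis by blast
  qed
  with A8 assms show ?thesis by (simp add: truth_BinOp)
next
  case (A10 \<alpha>)
  with assms show ?thesis by (simp add: truth_BinOp truth_UnOp truth_swap_universe)
next
  case (A11 \<alpha> \<beta>)
  \<comment> \<open>With \<open>a\<close>, \<open>b\<close>, \<open>c\<close> the coordinates of the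
    value of \<open>\<alpha>\<close>, the three complements gather into the complement of their
    meet, which is \<open>bot\<close>.\<close>
  have "sup (- c) (sup (- a) (sup (- b) d)) = top" if "inf (inf a b) c = bot" for a b c d :: 'b
  proof -
    have "sup (- c) (sup (- a) (sup (- b) d)) = sup (- inf (inf a b) c) d"
      by (simp add: sup_aci)
    then show ?thesis unfolding that by simp
  qed
  with A11 assms truth_swap_universe(2)[of \<alpha> \<mu>] show ?thesis
    by (simp add: truth_BinOp truth_UnOp)
next
  case (Ax12 t x \<psi>)
  then have F: "\<psi> \<in> For \<Xi>U" "\<psi>[x \<^bold>/ t] \<in> For \<Xi>U"
    using assms(2) by simp_all
  obtain a where "a \<in> dom \<AA>" "truth \<mu> (\<psi>[x \<^bold>/ t]) = truth (\<mu>(x := a)) \<psi>"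
    using truth_subst1_witness[OF F \<mu> Ax12(2)] .
  then have "truth \<mu> (\<psi>[x \<^bold>/ t]) \<le> truth \<mu> (Quant Exists x \<psi>)"
    unfolding truth_Exists[OF F(1) \<mu>] by (simp only:) (rule SUP_upper; simp)
  then show ?thesis using Ax12 assms by (simp only: truth_Imp_iff)
next
  case (Ax13 t x \<psi>)
  then have F: "\<psi> \<in> For \<Xi>U" "\<psi>[x \<^bold>/ t] \<in> For \<Xi>U"
    using assms(2) by simp_all
  obtain a where "a \<in> dom \<AA>" "truth \<mu> (\<psi>[x \<^bold>/ t]) = truth (\<mu>(x := a)) \<psi>"
    using truth_subst1_witness[OF F \<mu> Ax13(2)] .
  then have "truth \<mu> (Quant Forall x \<psi>) \<le> truth \<mu> (\<psi>[x \<^bold>/ t])"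
    unfolding truth_Forall[OF F(1) \<mu>] by (simp only:) (rule INF_lower; simp)
  then show ?thesis using Ax13 assms by (simp only: truth_Imp_iff)
next
  case (Ax14 \<alpha> \<beta>)
  then have "variant (close \<mu> \<alpha>) (close \<mu> \<beta>)"
    by (simp add: close_def variant_subst)
  then have "v (close \<mu> \<alpha>) = v (close \<mu> \<beta>)"
    using Ax14 assms by (intro v_variant close_Sen) auto
  then show ?thesis using Ax14 assms by (simp only: truth_Imp_iff)
next
  case (AxEq1 x)
  \<comment> \<open>Standard equality enters here: the diagonal of the interpretation of
    \<open>Eq\<close> is designated, so the infimum is one of constant \<open>top\<close>.\<close>
  have "truth (\<mu>(x := a)) (Var x \<^bold>\<approx> Var x) = top" if "a \<in> dom \<AA>" for a
  proof -
    have "close (\<mu>(x := a)) (Var x \<^bold>\<approx> Var x) \<in> Sen \<Xi>U"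
      using AxEq1 assms that by (intro close_Sen assignments_upd) auto
    then have "v (close (\<mu>(x := a)) (Var x \<^bold>\<approx> Var x)) = pred_int \<AA> Eq [a, a]"
      using v_Pred[OF \<mu>] by (simp add: close_simps)
    then show ?thesis
      using std that by (auto simp add: standard_equality_def designated_def)
  qed
  then show ?thesis using AxEq1 assms by (simp add: truth_Forall)
next
  case (AxEq2 y x \<psi> \<psi>')
  \<comment> \<open>For distinct individuals standard equality only keeps the first coordinate of
    the equation from being \<open>top\<close>; the schema itself comes from clause (viii).\<close>
  then have "v (close \<mu> \<phi>) \<in> designated \<B>"
    using val_eq \<mu> assms(2) unfolding QmbC_eq_valuation_def by auto
  then show ?thesis by (simp add: designated_def)
qed (use \<mu> assms(2) in \<open>simp_all add: truth_BinOp sup_shunt shunt1 inf_sup_aci\<close>)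

text \<open>Premises are assumed true under every assignment because the quantifier rules use them
  at \<open>\<mu>(x := a)\<close> for all \<open>a\<close>.\<close>

lemma rule_sound:
  assumes "rule Ps \<phi>" "\<phi> \<in> For (eq_sig \<Theta>)" "Ps \<subseteq> For (eq_sig \<Theta>)"
    and prems: "\<And>\<psi> \<mu>. \<psi> \<in> Ps \<Longrightarrow> \<mu> \<in> assignments \<AA> \<Longrightarrow> truth \<mu> (lift_fm \<psi>) = top"
    and \<mu>: "\<mu> \<in> assignments \<AA>"
  shows "truth \<mu> (lift_fm \<phi>) = top"
  using assms(1)
proof (cases rule: rule.cases)
  case (MP \<alpha>)
  \<comment> \<open>\<open>\<alpha>\<close> is absent from the conclusion, so its membership in the
    language must come from the premises.\<close>
  then have "lift_fm \<alpha> \<^bold>\<rightarrow> lift_fm \<phi> \<in> For \<Xi>U"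
    using assms(2,3) by (auto intro: lift_For)
  then have "truth \<mu> (lift_fm \<alpha>) \<le> truth \<mu> (lift_fm \<phi>)"
    using prems[of "\<alpha> \<^bold>\<rightarrow> \<phi>" \<mu>] MP \<mu> truth_Imp_iff by fastforce
  then show ?thesis using prems[of \<alpha> \<mu>] MP \<mu> top_le by auto
next
  case (Ex_In x \<psi> \<chi>)
  then have F: "lift_fm \<chi> \<in> For \<Xi>U" "lift_fm \<psi> \<in> For \<Xi>U"
    using assms(2) by (auto intro: lift_For)
  \<comment> \<open>As \<open>x\<close> is not free in \<open>\<psi>\<close>, the right side does
    not move with \<open>a\<close> and bounds the whole family, hence its supremum. The rule for
    \<open>Forall\<close> is dual.\<close>
  have "truth (\<mu>(x := a)) (lift_fm \<chi>) \<le> truth \<mu> (lift_fm \<psi>)" if "a \<in> dom \<AA>" for a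
  proof -
    have "close (\<mu>(x := a)) (lift_fm \<psi>) = close \<mu> (lift_fm \<psi>)"
      by (rule close_upd_not_free) (use Ex_In in simp)
    then show ?thesis
      using prems[of "\<chi> \<^bold>\<rightarrow> \<psi>" "\<mu>(x := a)"] truth_Imp_iff[of "lift_fm \<chi>" "lift_fm \<psi>" "\<mu>(x := a)"]
        F Ex_In assignments_upd[OF \<mu> that] by simp
  qed
  then have "truth \<mu> (Quant Exists x (lift_fm \<chi>)) \<le> truth \<mu> (lift_fm \<psi>)"
    using F \<mu> by (simp add: truth_Exists SUP_least)
  then show ?thesis
    using Ex_In truth_Imp_iff[of "Quant Exists x (lift_fm \<chi>)" "lift_fm \<psi>" \<mu>] F \<mu> by simp
next
  case (All_In x \<chi> \<psi>)
  then have F: "lift_fm \<chi> \<in> For \<Xi>U" "lift_fm \<psi> \<in> For \<Xi>U"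
    using assms(2) by (auto intro: lift_For)
  have "truth \<mu> (lift_fm \<chi>) \<le> truth (\<mu>(x := a)) (lift_fm \<psi>)" if "a \<in> dom \<AA>" for a
  proof -
    have "close (\<mu>(x := a)) (lift_fm \<chi>) = close \<mu> (lift_fm \<chi>)"
      by (rule close_upd_not_free) (use All_In in simp)
    then show ?thesis
      using prems[of "\<chi> \<^bold>\<rightarrow> \<psi>" "\<mu>(x := a)"] truth_Imp_iff[of "lift_fm \<chi>" "lift_fm \<psi>" "\<mu>(x := a)"]
        F All_In assignments_upd[OF \<mu> that] by simp
  qed
  then have "truth \<mu> (lift_fm \<chi>) \<le> truth \<mu> (Quant Forall x (lift_fm \<psi>))"
    using F \<mu> by (simp add: truth_Forall INF_greatest)
  then show ?thesis
    using All_In truth_Imp_iff[of "lift_fm \<chi>" "Quant Forall x (lift_fm \<psi>)" \<mu>] F \<mu> by simp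
qed

text \<open>Strong induction on the position, with \<open>\<mu>\<close> generalised: a quantifier
  rule calls on an earlier step under other assignments, so truth under all of them is the
  invariant.\<close>

lemma derivation_sound:
  assumes "derivation \<Theta> \<Gamma> ds"
    and \<Gamma>: "\<And>\<gamma> \<mu>. \<gamma> \<in> \<Gamma> \<Longrightarrow> \<mu> \<in> assignments \<AA> \<Longrightarrow> truth \<mu> (lift_fm \<gamma>) = top"
    and "i < length ds" "\<mu> \<in> assignments \<AA>"
  shows "truth \<mu> (lift_fm (ds ! i)) = top"
  using assms(3,4)
proof (induction i arbitrary: \<mu> rule: less_induct)
  case (less i)
  have F: "set ds \<subseteq> For (eq_sig \<Theta>)"
    using assms(1) by (simp add: derivation_def)
  then have Fi: "ds ! i \<in> For (eq_sig \<Theta>)"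
    using less.prems by auto
  consider "axiom (ds ! i)" | "ds ! i \<in> \<Gamma>" | Ps where "Ps \<subseteq> set (take i ds)" "rule Ps (ds ! i)"
    using assms(1) less.prems(1) unfolding derivation_def by blast
  then show ?case
  proof cases
    case 1
    then have "axiom (lift_fm (ds ! i))"
      by (intro axiom_map_fm) simp_all
    then show ?thesis
      using axiom_sound lift_For[OF Fi] less.prems by blast
  next
    case 2
    then show ?thesis using \<Gamma> less.prems by blast
  next
    case 3
    show ?thesis
    proof (rule rule_sound[OF 3(2) Fi _ _ less.prems(2)])
      show "Ps \<subseteq> For (eq_sig \<Theta>)"
        using 3(1) F set_take_subset by fastforce
    next
      fix \<psi> \<nu> assume "\<psi> \<in> Ps" "\<nu> \<in> assignments \<AA>"
      moreover from this(1) 3(1) have "\<psi> \<in> set (take i ds)"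
        by blast
      then obtain j where "j < i" "\<psi> = ds ! j"
        by (auto simp: in_set_conv_nth)
      ultimately show "truth \<nu> (lift_fm \<psi>) = top"
        using less.prems(1) by (auto intro!: less.IH)
    qed
  qed
qed

end

theorem theorem10p5:
  fixes \<Theta> :: "('c, 'f, 'p) signature"
    and \<Gamma> :: "('c, 'f, 'p eq_pred) fm set"
    and \<phi> :: "('c, 'f, 'p eq_pred) fm"
  assumes "\<Gamma> \<union> {\<phi>} \<subseteq> For (eq_sig \<Theta>)"
    and "derives \<Theta> \<Gamma> \<phi>"
  shows "entails TYPE('b::{boolean_algebra, complete_lattice}) TYPE('u) \<Theta> \<Gamma> \<phi>"
  unfolding entails_def consequence_in_def
proof (intro allI impI ballI, elim conjE)
  fix \<B> :: "'b swap" and \<AA> :: "('c, 'f, 'p eq_pred, 'u, 'b) struct" and v \<mu>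
  assume S: "swap_structure \<B>" "is_structure (eq_sig \<Theta>) \<B> \<AA>" "standard_equality \<B> \<AA>"
    "QmbC_eq_valuation \<Theta> \<B> \<AA> v"
    and \<Gamma>: "\<forall>\<gamma>\<in>\<Gamma>. \<forall>\<mu>\<in>assignments \<AA>. v (close \<mu> (lift_fm \<gamma>)) \<in> designated \<B>"
    and \<mu>: "\<mu> \<in> assignments \<AA>"
  interpret swap_eq_valuation \<Theta> \<B> \<AA> v
    using S by unfold_locales (auto simp: QmbC_eq_valuation_def)
  obtain ds where ds: "derivation \<Theta> \<Gamma> ds" "ds \<noteq> []" "last ds = \<phi>"
    using assms(2) by (auto simp: derives_def)
  \<comment> \<open>The derived formula is the last step; its index is valid because
    \<open>ds\<close> is nonempty.\<close>
  have "truth \<mu> (lift_fm (ds ! (length ds - 1))) = top"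
    by (rule derivation_sound[OF ds(1) _ _ \<mu>]) (use \<Gamma> ds(2) in \<open>auto simp: designated_def\<close>)
  moreover have "lift_fm \<phi> \<in> For \<Xi>U"
    using assms(1) by (auto intro: lift_For)
  ultimately show "v (close \<mu> (lift_fm \<phi>)) \<in> designated \<B>"
    using ds \<mu> by (simp add: designated_iff last_conv_nth)
qed

end
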